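(* Let $n\ge0$, let $\mathsf n,\mathsf n_0,\dots,\mathsf n_n$ be pairwise distinct names and let $u_0,\dots,u_n$ be (ground) contexts that do not contain these names. Let $s_0\equiv G(\mathsf{init}(\mathsf n))$ and $s_{i+1}\equiv G(\pi_S(s_i))$ for $0\le i<n$. Then the formula $$u_0[\pi_o(s_0)],\dots,u_n[\pi_o(s_n)]\ \sim\ u_0[\mathsf n_0],\dots,u_n[\mathsf n_n]$$ is derivable from the axioms listed in the context (the generic axioms and the axiom PRNG$_n$).
   Context: Syntax. Terms are built from names (sort $\mathsf{Nonce}$), function symbols $\mathcal F$, attacker function symbols $\mathcal G$. Sorts $\mathsf{bool},\mathsf{Nonce}<\mathsf{term}$. $\mathcal F$ contains $\oplus$, pairing, $\mathsf{EQ}(\_;\_)$, $\mathsf{if\,then\,else}$, $\mathsf{true},\mathsf{false},\mathbf 0$, and the pseudo-random generator symbols $G$, $\mathsf{init}$, $\pi_S$ (new internal state) and $\pi_o$ (generated number, of sort $\mathsf{Nonce}$). A context is a term with a hole (of sort $\mathsf{Nonce}$), and $u[t]$ is the result of filling the hole with $t$. Atomic formulas: $u_1,\dots,u_n\sim v_1,\dots,v_n$ with $u_i,v_i$ of the same sort; $u=v$ abbreviates $\mathsf{EQ}(u;v)\sim\mathsf{true}$. Derivable means obtained by finitely many uses of the following axioms (Horn clauses used as inference rules), instantiated with ground terms of appropriate sorts. Axioms. (PRNG$_n$) $\pi_o(s_0),\dots,\pi_o(s_n)\sim\mathsf n_0,\dots,\mathsf n_n$ where $s_0\equiv G(\mathsf{init}(\mathsf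 n))$ and $s_{i+1}\equiv G(\pi_S(s_i))$. (Refl, Sym, Trans) $\sim$ is an equivalence. (Dup) $\vec u,t\sim\vec v,t'\Rightarrow\vec u,t,t\sim\vec v,t',t'$. (Congr) $=$ is a congruence (equivalence, compatible with function symbols, and equal terms may be replaced inside $\sim$). (Perm) applying the same permutation to both sides of $\sim$. (FA) $\vec x,\vec y\sim\vec x',\vec y'\Rightarrow f(\vec x),\vec y\sim f(\vec x'),\vec y'$ for every function symbol $f$. (Equations) $\mathsf{EQ}(x;x)=\mathsf{true}$; $\mathsf{if}\,\mathsf{true}\,\mathsf{then}\,x\,\mathsf{else}\,y=x$; $\mathsf{if}\,\mathsf{false}\,\mathsf{then}\,x\,\mathsf{else}\,y=y$; $\mathsf{if}\,b\,\mathsf{then}\,x\,\mathsf{else}\,x=x$; $\mathsf{if}\,b\,\mathsf{then}\,(\mathsf{if}\,b\,\mathsf{then}\,x\,\mathsf{else}\,y)\,\mathsf{else}\,z=\mathsf{if}\,b\,\mathsf{then}\,x\,\mathsf{else}\,z$; $\mathsf{if}\,b\,\mathsf{then}\,x\,\mathsf{else}\,(\mathsf{if}\,b\,\mathsf{then}\,y\,\mathsf{else}\,z)=\mathsf{if}\,b\,\mathsf{then}\,x\,\mathsf{else}\,z$; $\mathsf{if}\,b\,\mathsf{then}\,(\mathsf{if}\,a\,\mathsf{then}\,x\,\mathsf{else}\,y)\,\mathsf{else}\,z=\mathsf{if}\,a\,\mathsf{then}\,(\mathsf{if}\,b\,\mathsf{then}\,x\,\mathsf{else}\,z)\,\mathsf{else}\,(\mathsf{if}\,b\,\mathsf{then}\,y\,\mathsf{else}\,z)$;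 $\mathsf{if}\,b\,\mathsf{then}\,x\,\mathsf{else}\,(\mathsf{if}\,a\,\mathsf{then}\,y\,\mathsf{else}\,z)=\mathsf{if}\,a\,\mathsf{then}\,(\mathsf{if}\,b\,\mathsf{then}\,x\,\mathsf{else}\,y)\,\mathsf{else}\,(\mathsf{if}\,b\,\mathsf{then}\,x\,\mathsf{else}\,z)$; $f(\vec x,\mathsf{if}\,b\,\mathsf{then}\,y\,\mathsf{else}\,z,\vec w)=\mathsf{if}\,b\,\mathsf{then}\,f(\vec x,y,\vec w)\,\mathsf{else}\,f(\vec x,z,\vec w)$; $\oplus$ is associative, commutative, $x\oplus x=\mathbf 0$, $\mathbf 0\oplus x=x$. (Indep) $\vec u\sim\vec v\Rightarrow\vec u,x\oplus\mathsf n\sim\vec v,y\oplus\mathsf n$ if the name $\mathsf n$ does not occur in $x,y,\vec u,\vec v$. (EqIndep) $\mathsf{EQ}(\mathsf n;x)=\mathsf{false}$ if $\mathsf n$ does not occur in $x$. (FreshNonce) $\vec u\sim\vec u'\Rightarrow\vec u,\mathsf n\sim\vec u',\mathsf n'$ if $\mathsf n$ does not occur in $\vec u$ and $\mathsf n'$ does not occur in $\vec u'$. (IfThen) $\mathsf{if}\,\mathsf{EQ}(x;y)\,\mathsf{then}\,t[x]\,\mathsf{else}\,z,\vec w\sim\vec x'\Rightarrow\mathsf{if}\,\mathsf{EQ}(x;y)\,\mathsf{then}\,t[y]\,\mathsf{else}\,z,\vec w\sim\vec x'$ for every context $t$. (CS) from $b,\mathsf{if}\,b\,\mathsf{then}\,x\,\mathsf{else}\,z,\vec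 u\sim b',\mathsf{if}\,b'\,\mathsf{then}\,x'\,\mathsf{else}\,z',\vec u'$ and $b,\mathsf{if}\,b\,\mathsf{then}\,z\,\mathsf{else}\,y,\vec u\sim b',\mathsf{if}\,b'\,\mathsf{then}\,z'\,\mathsf{else}\,y',\vec u'$ infer $\mathsf{if}\,b\,\mathsf{then}\,x\,\mathsf{else}\,y,\vec u\sim\mathsf{if}\,b'\,\mathsf{then}\,x'\,\mathsf{else}\,y',\vec u'$. *)

theory Defs
  imports Main "HOL-Combinatorics.Permutations"
begin

datatype sort = Bool | Nonce | Term

text \<open>The type parameters are the remaining function symbols of the signature
  (constructor Fn) and the attacker function symbols (constructor Att).
  State is the projection on the new internal state, Out the projection on the generated number.\<close>

datatype ('f, 'g) symbol =
    Xor | Pairing | Equal | Cond | Tru | Fls | Zero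
  | Gen | Init | State | Out
  | Fn 'f | Att 'g

text \<open>There are no variables: all terms are ground.\<close>

datatype ('f, 'g, names: 'n) trm =
    Name 'n
  | Fun "('f, 'g) symbol" "('f, 'g, 'n) trm list"

text \<open>A context is a term over the names extended with one more leaf, None, which is the hole;
  like the names it has sort Nonce. The hole may occur any number of times.\<close>

type_synonym ('f, 'g, 'n) ctxt = "('f, 'g, 'n option) trm"

primrec fill :: "('f, 'g, 'n) ctxt \<Rightarrow> ('f, 'g, 'n) trm \<Rightarrow> ('f, 'g, 'n) trm" where
  "fill (Name a) t = (case a of None \<Rightarrow> t | Some m \<Rightarrow> Name m)"
| "fill (Fun f us) t = Fun f (map (\<lambda>u. fill u t) us)"

definition ctxt_names :: "('f, 'g, 'n) ctxt \<Rightarrow> 'n set" where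
  "ctxt_names u = {m. Some m \<in> names u}"

text \<open>A symbol is declared with a set of profiles (argument sorts, result sort).
  The conditional is available at every sort, and exclusive or stays within Nonce on nonces.
  The profiles of the symbols not fixed here are arbitrary; a symbol without a profile occurs
  in no well-sorted term.\<close>

type_synonym profile = "sort list \<times> sort"

fun decls :: "('f \<Rightarrow> profile set) \<Rightarrow> ('g \<Rightarrow> profile set) \<Rightarrow> ('f, 'g) symbol \<Rightarrow> profile set" where
  "decls F A Xor = {([Nonce, Nonce], Nonce), ([Term, Term], Term)}"
| "decls F A Pairing = {([Term, Term], Term)}"
| "decls F A Equal = {([Term, Term], Bool)}"
| "decls F A Cond = {([Bool, s, s], s) | s. True}"
| "decls F A Tru = {([], Bool)}"
| "decls F A Fls = {([], Bool)}"
| "decls F A Zero = {([], Nonce)}"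
| "decls F A Gen = {([Term], Term)}"
| "decls F A Init = {([Term], Term)}"
| "decls F A State = {([Term], Term)}"
| "decls F A Out = {([Term], Nonce)}"
| "decls F A (Fn f) = F f"
| "decls F A (Att g) = A g"

inductive has_sort ::
  "(('f, 'g) symbol \<Rightarrow> profile set) \<Rightarrow> ('f, 'g, 'n) trm \<Rightarrow> sort \<Rightarrow> bool" for D where
  name: "has_sort D (Name m) Nonce"
| app: "(ss, s) \<in> D f \<Longrightarrow> list_all2 (has_sort D) ts ss \<Longrightarrow> has_sort D (Fun f ts) s"
| subsort: "has_sort D t s \<Longrightarrow> has_sort D t Term"

text \<open>Every well-sorted term has sort Term.\<close>

abbreviation well_sorted :: "(('f, 'g) symbol \<Rightarrow> profile set) \<Rightarrow> ('f, 'g, 'n) trm \<Rightarrow> bool" where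
  "well_sorted D t \<equiv> has_sort D t Term"

abbreviation xor where "xor x y \<equiv> Fun Xor [x, y]"
abbreviation EQ where "EQ x y \<equiv> Fun Equal [x, y]"
abbreviation ite where "ite b x y \<equiv> Fun Cond [b, x, y]"
abbreviation tru where "tru \<equiv> Fun Tru []"
abbreviation fls where "fls \<equiv> Fun Fls []"
abbreviation zero where "zero \<equiv> Fun Zero []"
abbreviation gen where "gen t \<equiv> Fun Gen [t]"
abbreviation init where "init t \<equiv> Fun Init [t]"
abbreviation pi_S where "pi_S t \<equiv> Fun State [t]"
abbreviation pi_o where "pi_o t \<equiv> Fun Out [t]"

primrec prng :: "'n \<Rightarrow> nat \<Rightarrow> ('f, 'g, 'n) trm" where
  "prng k 0 = gen (init (Name k))"
| "prng k (Suc i) = gen (pi_S (prng k i))"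

datatype ('f, 'g, 'n) formula =
  Sim "('f, 'g, 'n) trm list" "('f, 'g, 'n) trm list"  (infix "\<sim>" 50)

abbreviation eqn :: "('f, 'g, 'n) trm \<Rightarrow> ('f, 'g, 'n) trm \<Rightarrow> ('f, 'g, 'n) formula"
    (infix "\<doteq>" 50) where
  "x \<doteq> y \<equiv> [EQ x y] \<sim> [tru]"

text \<open>Since every well-sorted term has sort Term, two terms are of the same sort if they have
  exactly the same sorts.\<close>

definition same_sort ::
  "(('f, 'g) symbol \<Rightarrow> profile set) \<Rightarrow> ('f, 'g, 'n) trm \<Rightarrow> ('f, 'g, 'n) trm \<Rightarrow> bool" where
  "same_sort D x y \<longleftrightarrow>
     well_sorted D x \<and> well_sorted D y \<and> (\<forall>s. has_sort D x s \<longleftrightarrow> has_sort D y s)"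

fun well_formed :: "(('f, 'g) symbol \<Rightarrow> profile set) \<Rightarrow> ('f, 'g, 'n) formula \<Rightarrow> bool" where
  "well_formed D (us \<sim> vs) \<longleftrightarrow> list_all2 (same_sort D) us vs"

abbreviation fresh :: "'n \<Rightarrow> ('f, 'g, 'n) trm list \<Rightarrow> bool" where
  "fresh m ts \<equiv> \<forall>t\<in>set ts. m \<notin> names t"

text \<open>The clauses (premises, conclusion), where N is the index of the PRNG axiom.
  Well-formedness of the formulas is imposed in the definition of derivability below.\<close>

inductive clause ::
  "(('f, 'g) symbol \<Rightarrow> profile set) \<Rightarrow> nat \<Rightarrow>
   ('f, 'g, 'n) formula list \<Rightarrow> ('f, 'g, 'n) formula \<Rightarrow> bool" for D N where
  PRNG: "distinct (k # ns) \<Longrightarrow> length ns = Suc N \<Longrightarrow>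
    clause D N [] (map (\<lambda>i. pi_o (prng k i)) [0..<Suc N] \<sim> map Name ns)"
| Refl: "clause D N [] (us \<sim> us)"
| Sym: "clause D N [us \<sim> vs] (vs \<sim> us)"
| Trans: "clause D N [us \<sim> vs, vs \<sim> ws] (us \<sim> ws)"
| Dup: "clause D N [us @ [t] \<sim> vs @ [t']] (us @ [t, t] \<sim> vs @ [t', t'])"
| Congr_refl: "clause D N [] (x \<doteq> x)"
| Congr_sym: "clause D N [x \<doteq> y] (y \<doteq> x)"
| Congr_trans: "clause D N [x \<doteq> y, y \<doteq> z] (x \<doteq> z)"
| Congr_fun: "length xs = length ys \<Longrightarrow>
    clause D N (map2 (\<doteq>) xs ys) (Fun f xs \<doteq> Fun f ys)"
| Congr_sim: "clause D N [x \<doteq> y, us @ x # us' \<sim> vs] (us @ y # us' \<sim> vs)"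
| Perm: "p permutes {..<length us} \<Longrightarrow>
    clause D N [us \<sim> vs] (permute_list p us \<sim> permute_list p vs)"
| FA: "length xs = length xs' \<Longrightarrow>
    clause D N [xs @ ys \<sim> xs' @ ys'] (Fun f xs # ys \<sim> Fun f xs' # ys')"
| Eq_refl: "clause D N [] (EQ x x \<doteq> tru)"
| If_true: "clause D N [] (ite tru x y \<doteq> x)"
| If_false: "clause D N [] (ite fls x y \<doteq> y)"
| If_same: "clause D N [] (ite b x x \<doteq> x)"
| If_then_idem: "clause D N [] (ite b (ite b x y) z \<doteq> ite b x z)"
| If_else_idem: "clause D N [] (ite b x (ite b y z) \<doteq> ite b x z)"
| If_then_swap: "clause D N [] (ite b (ite a x y) z \<doteq> ite a (ite b x z) (ite b y z))"
| If_else_swap: "clause D N [] (ite b x (ite a y z) \<doteq> ite a (ite b x y) (ite b x z))"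
| If_fun: "clause D N []
    (Fun f (xs @ ite b y z # ws) \<doteq> ite b (Fun f (xs @ y # ws)) (Fun f (xs @ z # ws)))"
| Xor_assoc: "clause D N [] (xor (xor x y) z \<doteq> xor x (xor y z))"
| Xor_comm: "clause D N [] (xor x y \<doteq> xor y x)"
| Xor_self: "clause D N [] (xor x x \<doteq> zero)"
| Xor_zero: "clause D N [] (xor zero x \<doteq> x)"
| Indep: "fresh m (x # y # us @ vs) \<Longrightarrow>
    clause D N [us \<sim> vs] (us @ [xor x (Name m)] \<sim> vs @ [xor y (Name m)])"
| EqIndep: "fresh m [x] \<Longrightarrow> clause D N [] (EQ (Name m) x \<doteq> fls)"
| FreshNonce: "fresh m us \<Longrightarrow> fresh m' us' \<Longrightarrow>
    clause D N [us \<sim> us'] (us @ [Name m] \<sim> us' @ [Name m'])"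
| IfThen: "well_sorted D (t :: ('f, 'g, 'n) ctxt) \<Longrightarrow> has_sort D x Nonce \<Longrightarrow> has_sort D y Nonce \<Longrightarrow>
    clause D N [ite (EQ x y) (fill t x) z # ws \<sim> xs'] (ite (EQ x y) (fill t y) z # ws \<sim> xs')"
| CS: "clause D N
    [b # ite b x z # us \<sim> b' # ite b' x' z' # us',
     b # ite b z y # us \<sim> b' # ite b' z' y' # us']
    (ite b x y # us \<sim> ite b' x' y' # us')"

inductive derivable ::
  "(('f, 'g) symbol \<Rightarrow> profile set) \<Rightarrow> nat \<Rightarrow> ('f, 'g, 'n) formula \<Rightarrow> bool" for D N where
  "clause D N \<Gamma> \<phi> \<Longrightarrow> (\<forall>\<psi>\<in>set \<Gamma>. derivable D N \<psi>) \<Longrightarrow> well_formed D \<phi> \<Longrightarrow> derivable D N \<phi>"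

end

theory Submission
  imports Defs
begin

text \<open>Fresh names for all names of the contexts can be appended to both sides of PRNG, after
  which every u_i can be built by FA from copies of these entries. The axioms contain no rule for
  dropping an entry, but an entry x, next to another entry y, can be absorbed into y by means
  of if EQ(x; x) then y else y = y.\<close>

text \<open>Storing the two sides as one list of pairs keeps corresponding entries aligned, so that
  permuting, copying and dropping act on both sides at once.\<close>

abbreviation derivable_pairs ::
  "(('f, 'g) symbol \<Rightarrow> profile set) \<Rightarrow> nat \<Rightarrow>
   (('f, 'g, 'n) trm \<times> ('f, 'g, 'n) trm) list \<Rightarrow> bool" where
  "derivable_pairs D N ps \<equiv> derivable D N (map fst ps \<sim> map snd ps)"

section \<open>Sorts of terms and of filled contexts\<close>

lemma has_sort_Name [simp]: "has_sort D (Name m) s \<longleftrightarrow> s = Nonce \<or> s = Term"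
proof
  show "has_sort D (Name m) s \<Longrightarrow> s = Nonce \<or> s = Term"
    by (induction "Name m :: ('a, 'b, 'c) trm" s rule: has_sort.induct) auto
qed (auto intro: has_sort.intros)

lemma has_sort_Fun:
  "has_sort D (Fun f ts) s \<longleftrightarrow>
   (\<exists>ss s'. (ss, s') \<in> D f \<and> list_all2 (has_sort D) ts ss \<and> (s = s' \<or> s = Term))"
proof
  show "has_sort D (Fun f ts) s \<Longrightarrow>
    \<exists>ss s'. (ss, s') \<in> D f \<and> list_all2 (has_sort D) ts ss \<and> (s = s' \<or> s = Term)"
  proof (induction "Fun f ts" s rule: has_sort.induct)
    case (app ss s)
    then have "list_all2 (has_sort D) ts ss"
      by (auto elim: list_all2_mono)
    with app show ?case by blast
  qed blast
qed (auto intro: has_sort.intros)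

lemma well_sorted_args:
  assumes "well_sorted D (Fun f ts)" "t \<in> set ts"
  shows "well_sorted D t"
  using assms by (auto simp: has_sort_Fun list_all2_conv_all_nth in_set_conv_nth intro: subsort)

text \<open>The hole is a leaf with exactly the sorts of a name, and the assumption says the same of
  \<open>t\<close>, so no sort can change anywhere above it. Hence two fillings of one context
  always have the same sorts.\<close>

lemma has_sort_fill:
  assumes "\<And>s. has_sort D t s \<longleftrightarrow> s = Nonce \<or> s = Term"
  shows "has_sort D (fill c t) s \<longleftrightarrow> has_sort D c s"
proof (induction c arbitrary: s)
  case (Name a)
  then show ?case using assms by (cases a) auto
next
  case (Fun f cs)
  then have "list_all2 (has_sort D) (map (\<lambda>c. fill c t) cs) ss = list_all2 (has_sort D) cs ss" for ss
    by (auto simp: list_all2_conv_all_nth)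
  then show ?case by (simp add: has_sort_Fun)
qed

lemma has_sort_prng: "has_sort (decls F A) (prng k i) s \<longleftrightarrow> s = Term"
  by (induction i arbitrary: s) (auto simp: has_sort_Fun)

text \<open>Generated numbers thus have exactly the sorts of a name, which makes the PRNG formula
  well-formed and lets both kinds of term fill a hole.\<close>

lemma has_sort_pi_o_prng: "has_sort (decls F A) (pi_o (prng k i)) s \<longleftrightarrow> s = Nonce \<or> s = Term"
  by (auto simp: has_sort_Fun has_sort_prng)

lemma names_prng: "names (prng k i) = {k}"
  by (induction i) auto

section \<open>Derived rules on lists of pairs\<close>

lemma derivable_well_formed: "derivable D N \<phi> \<Longrightarrow> well_formed D \<phi>"
  by (erule derivable.cases) simp

lemma derivable_pairs_same_sort:
  assumes "derivable_pairs D N ps" "(x, y) \<in> set ps"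
  shows "same_sort D x y"
  using derivable_well_formed[OF assms(1)] assms(2)
  by (force simp: list_all2_conv_all_nth in_set_conv_nth)

lemma well_formed_pairs:
  "well_formed D (map fst ps \<sim> map snd ps) \<longleftrightarrow> (\<forall>(x, y) \<in> set ps. same_sort D x y)"
  by (force simp: list_all2_conv_all_nth in_set_conv_nth all_set_conv_all_nth)

lemma derivable_Sym:
  assumes "derivable D N (us \<sim> vs)"
  shows "derivable D N (vs \<sim> us)"
proof (rule derivable.intros[OF clause.Sym])
  show "well_formed D (vs \<sim> us)"
    using derivable_well_formed[OF assms] by (auto simp: list_all2_conv_all_nth same_sort_def)
qed (use assms in auto)

text \<open>A single permutation of the list of pairs induces the same permutation of both
  projections, as Perm requires. From here on the order of entries is immaterial.\<close>

lemma derivable_pairs_perm: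
  assumes "derivable_pairs D N ps" "mset qs = mset ps"
  shows "derivable_pairs D N qs"
proof -
  obtain p where p: "p permutes {..<length ps}" "permute_list p ps = qs"
    using mset_eq_permutation[OF assms(2)] by blast
  have "clause D N [map fst ps \<sim> map snd ps]
      (permute_list p (map fst ps) \<sim> permute_list p (map snd ps))"
    using p by (intro clause.Perm) auto
  then have "clause D N [map fst ps \<sim> map snd ps] (map fst qs \<sim> map snd qs)"
    using p by (simp add: permute_list_map)
  moreover have "well_formed D (map fst qs \<sim> map snd qs)"
    using derivable_well_formed[OF assms(1)] mset_eq_setD[OF assms(2)]
    unfolding well_formed_pairs by simp
  ultimately show ?thesis using assms(1) by (auto intro: derivable.intros)
qed

lemma derivable_pairs_copy:
  assumes "derivable_pairs D N ps" "p \<in> set ps"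
  shows "derivable_pairs D N (p # ps)"
proof -
  \<comment> \<open>Dup duplicates only the last entry, so \<open>p\<close> is first moved to the
    end.\<close>
  obtain qs where qs: "mset ps = mset (qs @ [p])"
  proof
    show "mset ps = mset (remove1 p ps @ [p])"
      using assms(2) by simp
  qed
  have d: "derivable_pairs D N (qs @ [p])"
    by (rule derivable_pairs_perm[OF assms(1)]) (use qs in simp)
  have "derivable_pairs D N (qs @ [p, p])"
  proof (rule derivable.intros)
    show "clause D N [map fst (qs @ [p]) \<sim> map snd (qs @ [p])]
        (map fst (qs @ [p, p]) \<sim> map snd (qs @ [p, p]))"
      using clause.Dup[of D N "map fst qs" "fst p" "map snd qs" "snd p"] by simp
    show "well_formed D (map fst (qs @ [p, p]) \<sim> map snd (qs @ [p, p]))"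
      using derivable_well_formed[OF d] unfolding well_formed_pairs by simp
  qed (use d in auto)
  then show ?thesis
    by (rule derivable_pairs_perm) (use qs in simp)
qed

text \<open>The sort assumption supplies the well-formedness of the conclusion: \<open>f\<close> may
  have no profile that fits the arguments.\<close>

lemma derivable_pairs_FA:
  assumes "derivable_pairs D N (ps @ qs)"
    and "same_sort D (Fun f (map fst ps)) (Fun f (map snd ps))"
  shows "derivable_pairs D N ((Fun f (map fst ps), Fun f (map snd ps)) # qs)"
proof (rule derivable.intros)
  show "clause D N [map fst (ps @ qs) \<sim> map snd (ps @ qs)]
     (map fst ((Fun f (map fst ps), Fun f (map snd ps)) # qs) \<sim>
      map snd ((Fun f (map fst ps), Fun f (map snd ps)) # qs))"
    using clause.FA[of "map fst ps" "map snd ps" D N "map fst qs" "map snd qs" f] by simp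
  show "well_formed D (map fst ((Fun f (map fst ps), Fun f (map snd ps)) # qs) \<sim>
      map snd ((Fun f (map fst ps), Fun f (map snd ps)) # qs))"
    using derivable_well_formed[OF assms(1)] assms(2) unfolding well_formed_pairs by simp
qed (use assms in auto)

section \<open>Dropping entries\<close>

lemma has_sort_ite_EQ:
  assumes "well_sorted (decls F A) x"
  shows "has_sort (decls F A) (ite (EQ x x) y y) s \<longleftrightarrow> has_sort (decls F A) y s"
proof
  assume "has_sort (decls F A) (ite (EQ x x) y y) s"
  then show "has_sort (decls F A) y s"
    by (auto simp: has_sort_Fun intro: subsort)
next
  have "has_sort (decls F A) (EQ x x) Bool"
    using assms by (simp add: has_sort_Fun)
  moreover assume "has_sort (decls F A) y s"
  \<comment> \<open>\<open>Cond\<close> has a profile for every sort, so the one at \<open>s\<close>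
    itself applies.\<close>
  ultimately show "has_sort (decls F A) (ite (EQ x x) y y) s"
    by (auto simp: has_sort_Fun[of _ Cond])
qed

text \<open>If_same gives the equation, and Congr_sim rewrites with it at the head of the left side;
  the right side is reached through Sym.\<close>

lemma derivable_ite_EQ:
  assumes "derivable (decls F A) N (ite (EQ x x) y y # us \<sim> vs)"
    and "well_sorted (decls F A) x" "well_sorted (decls F A) y"
  shows "derivable (decls F A) N (y # us \<sim> vs)"
proof (rule derivable.intros)
  show "clause (decls F A) N [ite (EQ x x) y y \<doteq> y, ite (EQ x x) y y # us \<sim> vs] (y # us \<sim> vs)"
    using clause.Congr_sim[of _ _ _ _ "[]"] by simp
  have "same_sort (decls F A) (EQ (ite (EQ x x) y y) y) tru"
    using assms by (auto simp: same_sort_def has_sort_Fun[of _ Equal] has_sort_Fun[of _ Tru]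
        has_sort_ite_EQ)
  then have "derivable (decls F A) N (ite (EQ x x) y y \<doteq> y)"
    by (intro derivable.intros[OF clause.If_same]) auto
  with assms show "\<forall>\<psi>\<in>set [ite (EQ x x) y y \<doteq> y, ite (EQ x x) y y # us \<sim> vs].
      derivable (decls F A) N \<psi>"
    by simp
  show "well_formed (decls F A) (y # us \<sim> vs)"
    using derivable_well_formed[OF assms(1)] assms(2,3)
    by (auto simp: list_all2_Cons1 same_sort_def has_sort_ite_EQ)
qed

lemma derivable_pairs_drop:
  assumes "derivable_pairs (decls F A) N (p # q # ps)"
  shows "derivable_pairs (decls F A) N (q # ps)"
proof -
  obtain x x' y y' where pq: "p = (x, x')" "q = (y, y')"
    by (metis surj_pair)
  have sx: "same_sort (decls F A) x x'" and sy: "same_sort (decls F A) y y'"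
    using derivable_pairs_same_sort[OF assms] pq by auto
  then have ws: "well_sorted (decls F A) x" "well_sorted (decls F A) x'"
    "well_sorted (decls F A) y" "well_sorted (decls F A) y'"
    by (auto simp: same_sort_def)
  \<comment> \<open>Two copies of each entry are needed: those of \<open>p\<close> become the
    arguments of the test, those of \<open>q\<close> the two branches.\<close>
  have "derivable_pairs (decls F A) N (q # p # q # ps)"
    by (rule derivable_pairs_copy[OF assms]) simp
  then have "derivable_pairs (decls F A) N (p # q # p # q # ps)"
    by (rule derivable_pairs_copy) simp
  then have "derivable_pairs (decls F A) N ([p, p] @ q # q # ps)"
    by (rule derivable_pairs_perm) simp
  then have "derivable_pairs (decls F A) N ((EQ x x, EQ x' x') # q # q # ps)"
    using derivable_pairs_FA[of _ _ "[p, p]" "q # q # ps" Equal] ws pq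
    by (auto simp: same_sort_def has_sort_Fun)
  then have "derivable_pairs (decls F A) N ([(EQ x x, EQ x' x'), q, q] @ ps)"
    by simp
  from derivable_pairs_FA[OF this, of Cond] sy ws
  have "derivable (decls F A) N
      (ite (EQ x x) y y # map fst ps \<sim> ite (EQ x' x') y' y' # map snd ps)"
    by (simp add: pq same_sort_def has_sort_ite_EQ)
  \<comment> \<open>The conditional is collapsed on the left, the sides are exchanged, and then it
    is collapsed on the other side.\<close>
  from derivable_ite_EQ[OF this]
  have "derivable (decls F A) N (ite (EQ x' x') y' y' # map snd ps \<sim> y # map fst ps)"
    using ws derivable_Sym by blast
  from derivable_ite_EQ[OF this] show ?thesis
    using ws derivable_Sym pq by auto
qed

lemma derivable_pairs_append_left:
  assumes "derivable_pairs (decls F A) N (ps @ qs)" "ps \<noteq> []"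
  shows "derivable_pairs (decls F A) N ps"
  using assms(1)
proof (induction qs)
  case (Cons q qs)
  \<comment> \<open>The head of \<open>ps\<close> is never removed; it absorbs the entries of
    \<open>qs\<close> one after the other.\<close>
  obtain p ps' where ps: "ps = p # ps'" using assms(2) by (cases ps) auto
  have "derivable_pairs (decls F A) N (q # p # ps' @ qs)"
    by (rule derivable_pairs_perm[OF Cons.prems]) (use ps in simp)
  then show ?case using derivable_pairs_drop ps Cons.IH by fastforce
qed simp

section \<open>Adding fresh names and building filled contexts\<close>

lemma derivable_pairs_fresh_names:
  assumes "derivable_pairs D N ps" "distinct ms"
    and "\<And>m x y. m \<in> set ms \<Longrightarrow> (x, y) \<in> set ps \<Longrightarrow> m \<notin> names x \<and> m \<notin> names y"
  shows "derivable_pairs D N (map (\<lambda>m. (Name m, Name m)) ms @ ps)"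
  using assms
proof (induction ms)
  case (Cons m ms)
  let ?qs = "map (\<lambda>m. (Name m, Name m)) ms @ ps"
  have d: "derivable_pairs D N ?qs"
    using Cons by simp
  \<comment> \<open>Distinctness keeps \<open>m\<close> apart from the names already added; the last
    assumption keeps it out of \<open>ps\<close>.\<close>
  have fr: "fresh m (map fst ?qs)" "fresh m (map snd ?qs)"
    using Cons.prems(2,3) by auto
  have "derivable_pairs D N (?qs @ [(Name m, Name m)])"
  proof (rule derivable.intros)
    show "clause D N [map fst ?qs \<sim> map snd ?qs]
        (map fst (?qs @ [(Name m, Name m)]) \<sim> map snd (?qs @ [(Name m, Name m)]))"
      using clause.FreshNonce[OF fr] by simp
    show "well_formed D (map fst (?qs @ [(Name m, Name m)]) \<sim> map snd (?qs @ [(Name m, Name m)]))"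
      using derivable_well_formed[OF d] unfolding well_formed_pairs by (auto simp: same_sort_def)
  qed (use d in auto)
  then show ?case by (rule derivable_pairs_perm) simp
qed simp

text \<open>Each leaf of the context is a copy of an entry of \<open>ps\<close>: the pair
  \<open>(t, t')\<close> for the hole, a pair of equal names otherwise. FA then builds the inner
  nodes, and \<open>ps\<close> stays behind as a supply for further contexts.\<close>

lemma derivable_pairs_fill:
  assumes "\<And>s. has_sort D t s \<longleftrightarrow> s = Nonce \<or> s = Term"
    and "\<And>s. has_sort D t' s \<longleftrightarrow> s = Nonce \<or> s = Term"
    and "derivable_pairs D N ps" "well_sorted D c" "(t, t') \<in> set ps"
    and "\<And>m. m \<in> ctxt_names c \<Longrightarrow> (Name m, Name m) \<in> set ps"
  shows "derivable_pairs D N ((fill c t, fill c t') # ps)"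
  using assms(3-)
proof (induction c arbitrary: ps)
  case (Name a)
  then show ?case
    by (cases a) (auto simp: ctxt_names_def intro!: derivable_pairs_copy simp del: list.map)
next
  case (Fun f cs)
  \<comment> \<open>The arguments are built one by one. Those already built join the supply for the
    next one, which is why \<open>ps\<close> is arbitrary in the outer induction.\<close>
  have args: "derivable_pairs D N (map (\<lambda>c. (fill c t, fill c t')) ds @ ps)"
    if "set ds \<subseteq> set cs" for ds
    using that
  proof (induction ds)
    case Nil
    then show ?case using Fun.prems by simp
  next
    case (Cons d ds)
    have "derivable_pairs D N ((fill d t, fill d t') # map (\<lambda>c. (fill c t, fill c t')) ds @ ps)"
    proof (rule Fun.IH)
      show "well_sorted D d"
        using Fun.prems(2) Cons.prems by (auto intro: well_sorted_args)
      show "(Name m, Name m) \<in> set (map (\<lambda>c. (fill c t, fill c t')) ds @ ps)"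
        if "m \<in> ctxt_names d" for m
        using that Fun.prems(4)[of m] Cons.prems by (auto simp: ctxt_names_def)
    qed (use Fun.prems Cons in auto)
    then show ?case by simp
  qed
  have "same_sort D (fill (Fun f cs) t) (fill (Fun f cs) t')"
    using Fun.prems(2) unfolding same_sort_def
    by (simp add: has_sort_fill[OF assms(1)] has_sort_fill[OF assms(2)] del: fill.simps)
  then show ?case
    using derivable_pairs_FA[OF args[OF order_refl], of f] by (simp add: comp_def)
qed

lemma finite_names: "finite (names t)"
  by (induction t) auto

lemma finite_ctxt_names: "finite (ctxt_names c)"
proof -
  have "ctxt_names c = Some -` names c"
    by (auto simp: ctxt_names_def)
  then show ?thesis
    by (simp add: finite_vimageI finite_names)
qed

section \<open>Derivation of the indistinguishability of the filled contexts\<close>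

theorem proposition6:
  fixes F :: "'f \<Rightarrow> profile set" and A :: "'g \<Rightarrow> profile set"
    and n :: nat and k :: 'n and ns :: "nat \<Rightarrow> 'n"
    and u :: "nat \<Rightarrow> ('f, 'g, 'n) ctxt"
  assumes "inj_on ns {..n}" and "k \<notin> ns ` {..n}"
    and "\<And>i. i \<le> n \<Longrightarrow> well_sorted (decls F A) (u i)"
    and "\<And>i. i \<le> n \<Longrightarrow> ctxt_names (u i) \<inter> insert k (ns ` {..n}) = {}"
  shows "derivable (decls F A) n
           (map (\<lambda>i. fill (u i) (pi_o (prng k i))) [0..<Suc n] \<sim>
            map (\<lambda>i. fill (u i) (Name (ns i))) [0..<Suc n])"
proof -
  define D where "D = decls F A"
  define out :: "nat \<Rightarrow> ('f, 'g, 'n) trm \<times> ('f, 'g, 'n) trm"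
    where "out i = (pi_o (prng k i), Name (ns i))" for i
  define filled where "filled i = (fill (u i) (pi_o (prng k i)), fill (u i) (Name (ns i)))" for i
  have le: "i \<in> set [0..<Suc n] \<longleftrightarrow> i \<le> n" for i by auto
  have PRNG: "derivable_pairs D n (map out [0..<Suc n])"
  proof (rule derivable.intros)
    have "distinct (k # map ns [0..<Suc n])"
      using assms(1,2) le by (auto simp: distinct_map inj_on_def simp del: upt_Suc)
    from clause.PRNG[OF this, of n D]
    show "clause D n [] (map fst (map out [0..<Suc n]) \<sim> map snd (map out [0..<Suc n]))"
      by (simp add: out_def comp_def del: upt_Suc)
    show "well_formed D (map fst (map out [0..<Suc n]) \<sim> map snd (map out [0..<Suc n]))"
      unfolding well_formed_pairs by (auto simp: out_def same_sort_def D_def has_sort_pi_o_prng)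
  qed simp
  \<comment> \<open>All names of all the contexts are collected in one finite list, so that they can
    be added before any context is built.\<close>
  have "finite (\<Union>i\<le>n. ctxt_names (u i))"
    by (simp add: finite_ctxt_names)
  then obtain ms where ms: "set ms = (\<Union>i\<le>n. ctxt_names (u i))" "distinct ms"
    by (metis finite_distinct_list)
  \<comment> \<open>The only names in the PRNG entries are \<open>k\<close> and the
    \<open>ns i\<close>, which the contexts avoid.\<close>
  have fresh_ms: "m \<notin> names x \<and> m \<notin> names y"
    if m: "m \<in> set ms" and xy: "(x, y) \<in> set (map out [0..<Suc n])" for m x y
  proof -
    from xy obtain i where "i \<in> set [0..<Suc n]" "(x, y) = out i"
      unfolding set_map by (rule imageE)
    then have i: "i \<le> n" "x = pi_o (prng k i)" "y = Name (ns i)"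
      using le by (auto simp: out_def)
    obtain j where j: "j \<le> n" "m \<in> ctxt_names (u j)"
      using m ms(1) by auto
    have "m \<notin> insert k (ns ` {..n})"
      using assms(4)[OF j(1)] j(2) by blast
    then show ?thesis using i by (auto simp: names_prng)
  qed
  have base:
    "derivable_pairs D n (map (\<lambda>m. (Name m, Name m)) ms @ map out [0..<Suc n])"
    (is "derivable_pairs D n ?base")
    by (rule derivable_pairs_fresh_names[OF PRNG ms(2) fresh_ms])
  \<comment> \<open>For each index, \<open>?base\<close> provides the pair \<open>out i\<close> for
    the hole and the names from \<open>ms\<close> for the other leaves.\<close>
  have "derivable_pairs D n (map filled is @ ?base)" if "set is \<subseteq> {..n}" for "is"
    using that
  proof (induction "is")
    case Nil
    then show ?case using base by simp
  next
    case (Cons i "is")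
    have "derivable_pairs D n (filled i # map filled is @ ?base)"
      unfolding filled_def
    proof (rule derivable_pairs_fill, goal_cases)
      case 5
      have "out i \<in> set (map out [0..<Suc n])"
        using Cons.prems by (simp add: le del: upt_Suc)
      then show ?case by (simp add: out_def del: upt_Suc)
    next
      case (6 m)
      then show ?case using Cons.prems ms(1) by auto
    qed (use Cons assms(3) in \<open>auto simp: D_def has_sort_pi_o_prng filled_def[abs_def]\<close>)
    then show ?case by simp
  qed
  then have "derivable_pairs D n (map filled [0..<Suc n] @ ?base)"
    by (simp add: le subset_iff del: upt_Suc)
  \<comment> \<open>The supply is now absorbed; at least one entry is left to absorb it, since index
    0 is always present.\<close>
  then have "derivable_pairs D n (map filled [0..<Suc n])"
    unfolding D_def by (rule derivable_pairs_append_left) simp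
  then show ?thesis
    by (simp add: D_def filled_def comp_def del: upt_Suc)
qed

end
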